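(* Let $(h_\alpha)$, $\alpha\in\mathbb{R}$, be a parametrized family of distortion functions with $h_{\alpha_0}(y)=y$, applied to both the prior distribution function $F_\vartheta$ and the distribution function $F_X$. Assume that for $\Pi$-almost every $\theta$ the maps $\alpha\mapsto\log h'_\alpha(F_\vartheta(\theta))$ and $\alpha\mapsto\log h'_\alpha(F_X(x_i|\theta))$, $i=1,\dots,n$, are differentiable at $\alpha=\alpha_0$. Let $\delta_0>0$, let $g:\Theta\to\mathbb{R}^s$ be measurable, and assume that for some $G(\cdot,\alpha_0)\in L^1(\Pi)$, $$\left|\delta^{-1}g(\theta)\big(\mathcal{L}_{h_{\alpha_0+\delta}}(\theta)h'_{\alpha_0+\delta}(F_\vartheta(\theta))-\mathcal{L}_{h_{\alpha_0}}(\theta)h'_{\alpha_0}(F_\vartheta(\theta))\big)\right|\le G(\theta,\alpha_0),\qquad|\delta|\le\delta_0,$$ holds for $\Pi$-almost every $\theta$. Then the Bayesian local sensitivity $\delta_n^{h_\alpha}=\frac{\partial}{\partial\alpha}\mathrm{E}_{\Pi^n_{h_\alpha}}[g(\vartheta)]\big|_{\alpha=\alpha_0}$ satisfies $$\delta_n^{h_\alpha}=\mathrm{Cov}_{\Pi^n}\Big[g(\vartheta),\ \frac{\partial}{\partial\alpha}\Big(\log h'_\alpha(F_\vartheta(\vartheta))+\sum_{i=1}^n\log h'_\alpha(F_X(x_i|\vartheta))\Big)\Big|_{\alpha=\alpha_0}\Big].$$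
   Context: Setting: $\Theta\subseteq\mathbb{R}^k$ is the parameter space with prior probability distribution $\Pi$; $\vartheta$ is the random parameter with law $\Pi$, distribution function $F_\vartheta$ and density $f_\vartheta$. Given $\theta\in\Theta$, $X$ is an $\mathbb{R}^d$-valued random vector with distribution $P_\theta$, distribution function $F_X(\cdot|\theta)$ and density $f_X(\cdot|\theta)$. The sample $x_{1:n}=(x_1,\dots,x_n)$ is a fixed realisation of an i.i.d. sample of $X$. The likelihood is $\mathcal{L}(\theta)=\prod_{i=1}^n f_X(x_i|\theta)$, and $\Pi^n$ is the posterior, $d\Pi^n(\theta)=\mathcal{L}(\theta)d\Pi(\theta)/\int_\Theta\mathcal{L}\,d\Pi$ (Bayes' rule is assumed to be well defined). A distortion function is a differentiable, non-decreasing $h:[0,1]\to[0,1]$ with $h(0)=0$, $h(1)=1$; $h'$ denotes its derivative. The $h$-distorted likelihood is $\mathcal{L}_h(\theta)=\prod_{i=1}^n f_X(x_i|\theta)\,h'(F_X(x_i|\theta))$. The $h$-distorted prior $\Pi_h$ is the one with distribution function $h\circ F_\vartheta$, with density $f_\vartheta(\theta)h'(F_\vartheta(\theta))$, i.e. $d\Pi_h(\theta)=h'(F_\vartheta(\theta))\,d\Pi(\theta)$. The distorted posterior (double distortion) is $\Pi^n_{h}(B)=\int_B\mathcal{L}_h\,d\Pi_h/\int_\Theta\mathcal{L}_h\,d\Pi_h$. In $h'_\alpha$, the prime is the derivative in the argument $y$ of $h_\alpha(y)$. $\mathrm{Cov}_{\Pi^n}[g(\vartheta),T(\vartheta)]$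 for $g$ valued in $\mathbb{R}^s$ and $T$ real-valued is the vector in $\mathbb{R}^s$ of covariances of the components of $g(\vartheta)$ with $T(\vartheta)$, for $\vartheta\sim\Pi^n$.
   Formalization: The domination condition is also assumed with g replaced by 1 (an integrable bound for the difference quotient of the normalising constant's integrand), since the claim fails without it; integrability of g under the posterior is assumed explicitly. *)

theory Defs
  imports "HOL-Probability.Probability"
begin

text \<open>
  The prior is a measure on the measurable subspace \<open>\<Theta>\<close> of Euclidean space, so integrals with
  respect to \<open>prior\<close> are integrals over \<open>\<Theta>\<close>. Joint measurability of the densities \<open>fX\<close> is part of
  Bayes' rule being well defined.
\<close>

locale bayes_model =
  fixes \<Theta> :: "(real ^ 'k) set"
    and prior :: "(real ^ 'k) measure"
    and f\<^sub>0 :: "real ^ 'k \<Rightarrow> real"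
    and P :: "real ^ 'k \<Rightarrow> (real ^ 'd) measure"
    and fX :: "real ^ 'k \<Rightarrow> real ^ 'd \<Rightarrow> real"
  assumes Theta_borel: "\<Theta> \<in> sets borel"
    and prior_prob: "prob_space prior"
    and prior_dens_measurable: "f\<^sub>0 \<in> borel_measurable (restrict_space borel \<Theta>)"
    and prior_dens_nonneg: "\<And>\<theta>. \<theta> \<in> \<Theta> \<Longrightarrow> 0 \<le> f\<^sub>0 \<theta>"
    and prior_dens: "prior = density (restrict_space lborel \<Theta>) (\<lambda>\<theta>. ennreal (f\<^sub>0 \<theta>))"
    and model_prob: "\<And>\<theta>. \<theta> \<in> \<Theta> \<Longrightarrow> prob_space (P \<theta>)"
    and model_dens_measurable:
      "(\<lambda>(\<theta>, y). fX \<theta> y) \<in> borel_measurable (restrict_space borel \<Theta> \<Otimes>\<^sub>M borel)"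
    and model_dens_nonneg: "\<And>\<theta> y. \<theta> \<in> \<Theta> \<Longrightarrow> 0 \<le> fX \<theta> y"
    and model_dens: "\<And>\<theta>. \<theta> \<in> \<Theta> \<Longrightarrow> P \<theta> = density lborel (\<lambda>y. ennreal (fX \<theta> y))"

text \<open>
  The order on \<open>real ^ 'n\<close> is the componentwise one. Intersecting with the space matters for
  measures on a proper subset of \<open>real ^ 'n\<close>.
\<close>

definition joint_cdf :: "(real ^ 'n) measure \<Rightarrow> real ^ 'n \<Rightarrow> real"
  where "joint_cdf M z = measure M {t \<in> space M. t \<le> z}"

definition distortion_function :: "(real \<Rightarrow> real) \<Rightarrow> bool"
  where "distortion_function h \<longleftrightarrow>
    h differentiable_on {0..1} \<and> mono_on {0..1} h \<and> h ` {0..1} \<subseteq> {0..1} \<and> h 0 = 0 \<and> h 1 = 1"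

text \<open>The derivative is one-sided at the end points of the unit interval.\<close>

definition distortion_deriv :: "(real \<Rightarrow> real) \<Rightarrow> real \<Rightarrow> real"
  where "distortion_deriv h y = vector_derivative h (at y within {0..1})"

definition likelihood :: "('p \<Rightarrow> real ^ 'd \<Rightarrow> real) \<Rightarrow> nat \<Rightarrow> (nat \<Rightarrow> real ^ 'd) \<Rightarrow> 'p \<Rightarrow> real"
  where "likelihood fX n x \<theta> = (\<Prod>i\<in>{1..n}. fX \<theta> (x i))"

definition distorted_likelihood ::
    "('p \<Rightarrow> (real ^ 'd) measure) \<Rightarrow> ('p \<Rightarrow> real ^ 'd \<Rightarrow> real) \<Rightarrow> nat \<Rightarrow> (nat \<Rightarrow> real ^ 'd)
      \<Rightarrow> (real \<Rightarrow> real) \<Rightarrow> 'p \<Rightarrow> real"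
  where "distorted_likelihood P fX n x h \<theta> =
    (\<Prod>i\<in>{1..n}. fX \<theta> (x i) * distortion_deriv h (joint_cdf (P \<theta>) (x i)))"

text \<open>
  In dimension one this is the law with distribution function \<open>h \<circ> joint_cdf prior\<close>. In higher
  dimension it need not be, and it need not have total mass one; the posterior is normalised.
\<close>

definition distorted_prior :: "(real ^ 'k) measure \<Rightarrow> (real \<Rightarrow> real) \<Rightarrow> (real ^ 'k) measure"
  where "distorted_prior prior h =
    density prior (\<lambda>\<theta>. ennreal (distortion_deriv h (joint_cdf prior \<theta>)))"

definition posterior :: "'p measure \<Rightarrow> ('p \<Rightarrow> real) \<Rightarrow> 'p measure"
  where "posterior prior L =
    density prior (\<lambda>\<theta>. ennreal (L \<theta>) / (\<integral>\<^sup>+ t. ennreal (L t) \<partial>prior))"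

definition distorted_posterior ::
    "(real ^ 'k) measure \<Rightarrow> (real ^ 'k \<Rightarrow> (real ^ 'd) measure) \<Rightarrow> (real ^ 'k \<Rightarrow> real ^ 'd \<Rightarrow> real)
      \<Rightarrow> nat \<Rightarrow> (nat \<Rightarrow> real ^ 'd) \<Rightarrow> (real \<Rightarrow> real) \<Rightarrow> (real ^ 'k) measure"
  where "distorted_posterior prior P fX n x h =
    posterior (distorted_prior prior h) (distorted_likelihood P fX n x h)"

definition distortion_score ::
    "(real ^ 'k) measure \<Rightarrow> (real ^ 'k \<Rightarrow> (real ^ 'd) measure)
      \<Rightarrow> nat \<Rightarrow> (nat \<Rightarrow> real ^ 'd) \<Rightarrow> (real \<Rightarrow> real \<Rightarrow> real) \<Rightarrow> real \<Rightarrow> real ^ 'k \<Rightarrow> real"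
  where "distortion_score prior P n x h \<alpha>\<^sub>0 \<theta> =
    deriv (\<lambda>\<alpha>. ln (distortion_deriv (h \<alpha>) (joint_cdf prior \<theta>))
      + (\<Sum>i\<in>{1..n}. ln (distortion_deriv (h \<alpha>) (joint_cdf (P \<theta>) (x i))))) \<alpha>\<^sub>0"

text \<open>
  \<open>ln\<close> is total with \<open>ln 0 = 0\<close>, so positivity near \<open>\<alpha>\<^sub>0\<close> is needed to express that the logarithm
  is defined there.
\<close>

definition log_differentiable_at :: "(real \<Rightarrow> real) \<Rightarrow> real \<Rightarrow> bool"
  where "log_differentiable_at w \<alpha>\<^sub>0 \<longleftrightarrow>
    (\<forall>\<^sub>F \<alpha> in nhds \<alpha>\<^sub>0. 0 < w \<alpha>) \<and> (\<lambda>\<alpha>. ln (w \<alpha>)) differentiable (at \<alpha>\<^sub>0)"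

definition covariance_vec :: "'p measure \<Rightarrow> ('p \<Rightarrow> real ^ 's) \<Rightarrow> ('p \<Rightarrow> real) \<Rightarrow> real ^ 's"
  where "covariance_vec M g T =
    (\<chi> j. \<integral>\<theta>. (g \<theta> $ j - (\<integral>t. g t $ j \<partial>M)) * (T \<theta> - (\<integral>t. T t \<partial>M)) \<partial>M)"

end

theory Submission
  imports Defs
begin

text \<open>
  The distorted posterior mean is a quotient \<open>(\<integral> w \<alpha> *\<^sub>R g) / (\<integral> w \<alpha>)\<close> of prior integrals, where the
  weight \<open>w \<alpha>\<close> is the distorted likelihood times the distorted prior density. Dominated convergence
  allows both integrals to be differentiated under the integral sign. Near \<open>\<alpha>\<^sub>0\<close> the weight is the
  undistorted likelihood times the exponential of the sum of the logarithms, so its derivative is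
  \<open>w \<alpha>\<^sub>0\<close> times the score, and the quotient rule produces the covariance.
\<close>

section \<open>Differentiation under the integral\<close>

text \<open>Puts the derivative in a form that can be tested along sequences tending to 0, which is
  what dominated convergence handles.\<close>

lemma has_vector_derivative_iff_difference_quotient:
  fixes f :: "real \<Rightarrow> 'b::real_normed_vector"
  shows "(f has_vector_derivative D) (at a) \<longleftrightarrow> ((\<lambda>d. (f (a + d) - f a) /\<^sub>R d) \<longlongrightarrow> D) (at 0)"
proof -
  have eq: "norm (f (a + d) - f a - d *\<^sub>R D) / norm d = norm ((f (a + d) - f a) /\<^sub>R d - D)"
    if "d \<noteq> 0" for d
  proof -
    have "(f (a + d) - f a) /\<^sub>R d - D = (f (a + d) - f a - d *\<^sub>R D) /\<^sub>R d"
      using that by (simp add: algebra_simps)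
    then show ?thesis
      by (simp add: divide_inverse_commute)
  qed
  have "(f has_vector_derivative D) (at a) \<longleftrightarrow>
      ((\<lambda>d. norm (f (a + d) - f a - d *\<^sub>R D) / norm d) \<longlongrightarrow> 0) (at 0)"
    by (simp add: has_vector_derivative_def has_derivative_at bounded_linear_scaleR_left)
  also have "\<dots> \<longleftrightarrow> ((\<lambda>d. norm ((f (a + d) - f a) /\<^sub>R d - D)) \<longlongrightarrow> 0) (at 0)"
    by (intro tendsto_cong eventually_mono[OF eventually_neq_at_within] eq)
  also have "\<dots> \<longleftrightarrow> ((\<lambda>d. (f (a + d) - f a) /\<^sub>R d) \<longlongrightarrow> D) (at 0)"
    by (simp add: tendsto_norm_zero_iff LIM_zero_iff)
  finally show ?thesis .
qed

lemma has_vector_derivative_LIMSEQ: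
  fixes f :: "real \<Rightarrow> 'b::real_normed_vector"
  assumes "(f has_vector_derivative D) (at a)" and "X \<longlonglongrightarrow> 0" and "\<And>i. X i \<noteq> 0"
  shows "(\<lambda>i. (f (a + X i) - f a) /\<^sub>R X i) \<longlonglongrightarrow> D"
  using assms unfolding has_vector_derivative_iff_difference_quotient tendsto_at_iff_sequentially
  by (auto simp: comp_def)

text \<open>\<open>D\<close> itself carries no measurability assumption. Difference quotients along
  1/(i+1) are measurable, and so is their \<open>lim\<close>, which is defined even where they
  diverge and equals \<open>D\<close> wherever the derivative exists.\<close>

lemma AE_derivative_measurable:
  fixes f :: "real \<Rightarrow> 'a \<Rightarrow> 'b::{banach, second_countable_topology}"
  assumes [measurable]: "\<And>a. f a \<in> borel_measurable M"
    and deriv: "AE x in M. ((\<lambda>a. f a x) has_vector_derivative D x) (at a\<^sub>0)"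
  obtains D' where "D' \<in> borel_measurable M" "AE x in M. D' x = D x"
proof
  define D' where
    "D' x = lim (\<lambda>i. (f (a\<^sub>0 + inverse (real (Suc i))) x - f a\<^sub>0 x) /\<^sub>R inverse (real (Suc i)))" for x
  show "D' \<in> borel_measurable M"
    unfolding D'_def by measurable
  show "AE x in M. D' x = D x"
    using deriv
  proof eventually_elim
    case (elim x)
    from has_vector_derivative_LIMSEQ[OF elim LIMSEQ_inverse_real_of_nat]
    show ?case
      unfolding D'_def by (intro limI) simp
  qed
qed

text \<open>Dominated convergence applied to difference quotients along sequences. The exceptional
  null set in \<open>bound\<close> may depend on \<delta>, since each sequence involves only
  countably many increments.\<close>

lemma integral_has_vector_derivative_dominated:
  fixes f :: "real \<Rightarrow> 'a \<Rightarrow> 'b::{banach, second_countable_topology}"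
  assumes meas [measurable]: "\<And>a. f a \<in> borel_measurable M" "D \<in> borel_measurable M"
    and int: "integrable M (f a\<^sub>0)"
    and deriv: "AE x in M. ((\<lambda>a. f a x) has_vector_derivative D x) (at a\<^sub>0)"
    and "0 < \<delta>\<^sub>0" and G: "integrable M G"
    and bound: "\<And>\<delta>. \<delta> \<noteq> 0 \<Longrightarrow> \<bar>\<delta>\<bar> \<le> \<delta>\<^sub>0 \<Longrightarrow>
      AE x in M. norm ((f (a\<^sub>0 + \<delta>) x - f a\<^sub>0 x) /\<^sub>R \<delta>) \<le> G x"
  shows "integrable M D"
    and "\<bar>\<delta>\<bar> \<le> \<delta>\<^sub>0 \<Longrightarrow> integrable M (f (a\<^sub>0 + \<delta>))"
    and "((\<lambda>a. \<integral>x. f a x \<partial>M) has_vector_derivative (\<integral>x. D x \<partial>M)) (at a\<^sub>0)"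
proof -
  let ?q = "\<lambda>\<delta> x. (f (a\<^sub>0 + \<delta>) x - f a\<^sub>0 x) /\<^sub>R \<delta>"
  have int_q: "integrable M (?q \<delta>)" if "\<bar>\<delta>\<bar> \<le> \<delta>\<^sub>0" for \<delta>
  proof (cases "\<delta> = 0")
    case False
    then show ?thesis
      using bound[OF False that] by (intro Bochner_Integration.integrable_bound[OF G]) auto
  qed simp
  show int_f: "integrable M (f (a\<^sub>0 + \<delta>))" if "\<bar>\<delta>\<bar> \<le> \<delta>\<^sub>0" for \<delta>
  proof (cases "\<delta> = 0")
    case False
    have "integrable M (\<lambda>x. f a\<^sub>0 x + \<delta> *\<^sub>R ?q \<delta> x)"
      by (intro Bochner_Integration.integrable_add integrable_scaleR_right int int_q[OF that])
    with False show ?thesis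
      by simp
  qed (simp add: int)
  have lim: "(\<lambda>i. \<integral>x. ?q (X i) x \<partial>M) \<longlonglongrightarrow> (\<integral>x. D x \<partial>M)" "integrable M D"
    if X: "X \<longlonglongrightarrow> 0" "\<And>i. X i \<noteq> 0" "\<And>i. \<bar>X i\<bar> \<le> \<delta>\<^sub>0" for X :: "nat \<Rightarrow> real"
  proof -
    have conv: "AE x in M. (\<lambda>i. ?q (X i) x) \<longlonglongrightarrow> D x"
      using deriv by eventually_elim (rule has_vector_derivative_LIMSEQ[OF _ X(1,2)])
    have dom: "AE x in M. norm (?q (X i) x) \<le> G x" for i
      by (rule bound[OF X(2,3)])
    have q: "?q (X i) \<in> borel_measurable M" for i
      by measurable
    show "(\<lambda>i. \<integral>x. ?q (X i) x \<partial>M) \<longlonglongrightarrow> (\<integral>x. D x \<partial>M)"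
      by (rule integral_dominated_convergence[OF meas(2) q G conv dom])
    show "integrable M D"
      by (rule integrable_dominated_convergence[OF meas(2) q G conv dom])
  qed
  \<comment> \<open>One admissible sequence suffices here; the factor
    \<open>\<delta>\<^sub>0\<close> keeps every term, including the first, within the range of the
    bound.\<close>
  show "integrable M D"
  proof (rule lim(2))
    show "(\<lambda>i. \<delta>\<^sub>0 * inverse (real (Suc i))) \<longlonglongrightarrow> 0"
      using tendsto_mult_right_zero[OF LIMSEQ_inverse_real_of_nat] by blast
    show "\<bar>\<delta>\<^sub>0 * inverse (real (Suc i))\<bar> \<le> \<delta>\<^sub>0" for i
      using \<open>0 < \<delta>\<^sub>0\<close> by (simp add: abs_mult field_simps)
  qed (use \<open>0 < \<delta>\<^sub>0\<close> in auto)
  have "((\<lambda>\<delta>. \<integral>x. ?q \<delta> x \<partial>M) \<longlongrightarrow> (\<integral>x. D x \<partial>M)) (at 0)"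
    unfolding tendsto_at_iff_sequentially comp_def
  proof (intro allI impI)
    fix X :: "nat \<Rightarrow> real"
    assume X: "\<forall>i. X i \<in> UNIV - {0}" "X \<longlonglongrightarrow> 0"
    have "\<forall>\<^sub>F i in sequentially. \<bar>X i\<bar> < \<delta>\<^sub>0"
      using X(2) \<open>0 < \<delta>\<^sub>0\<close> by (metis order_tendstoD(2) tendsto_rabs_zero)
    \<comment> \<open>An arbitrary null sequence may start outside the range of the bound; dropping
      its first \<open>N\<close> terms repairs this without changing the limit.\<close>
    then obtain N where N: "\<And>i. N \<le> i \<Longrightarrow> \<bar>X i\<bar> < \<delta>\<^sub>0"
      by (auto simp: eventually_sequentially)
    have "(\<lambda>i. \<integral>x. ?q (X (i + N)) x \<partial>M) \<longlonglongrightarrow> (\<integral>x. D x \<partial>M)"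
      using X N by (intro lim(1) LIMSEQ_ignore_initial_segment) (auto intro: less_imp_le)
    then show "(\<lambda>i. \<integral>x. ?q (X i) x \<partial>M) \<longlonglongrightarrow> (\<integral>x. D x \<partial>M)"
      by (rule LIMSEQ_offset)
  qed
  \<comment> \<open>Splitting the integral of the quotient requires
    \<open>f (a\<^sub>0 + \<delta>)\<close> to be integrable, which is known for small \<delta>
    only, so the two expressions are compared near 0.\<close>
  also have "?this \<longleftrightarrow> ((\<lambda>\<delta>. ((\<integral>x. f (a\<^sub>0 + \<delta>) x \<partial>M) - (\<integral>x. f a\<^sub>0 x \<partial>M)) /\<^sub>R \<delta>) \<longlongrightarrow> (\<integral>x. D x \<partial>M)) (at 0)"
  proof (intro tendsto_cong)
    have "\<forall>\<^sub>F \<delta> in at 0. \<bar>\<delta>\<bar> < \<delta>\<^sub>0"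
      using \<open>0 < \<delta>\<^sub>0\<close> by (auto simp: eventually_at dist_real_def)
    then show "\<forall>\<^sub>F \<delta> in at 0. (\<integral>x. ?q \<delta> x \<partial>M) = ((\<integral>x. f (a\<^sub>0 + \<delta>) x \<partial>M) - (\<integral>x. f a\<^sub>0 x \<partial>M)) /\<^sub>R \<delta>"
      by eventually_elim (simp add: int int_f)
  qed
  finally show "((\<lambda>a. \<integral>x. f a x \<partial>M) has_vector_derivative (\<integral>x. D x \<partial>M)) (at a\<^sub>0)"
    by (simp add: has_vector_derivative_iff_difference_quotient)
qed

section \<open>Measurability with respect to the completion\<close>

text \<open>Preimages of a Borel set under \<open>f\<close> and \<open>g\<close> differ by a subset
  of a null set, and the completion contains all such subsets. This serves the score, which is not
  assumed measurable.\<close>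

lemma borel_measurable_completion_AE:
  fixes f g :: "'a \<Rightarrow> 'b::topological_space"
  assumes [measurable]: "f \<in> borel_measurable M" and eq: "AE x in M. f x = g x"
  shows "g \<in> borel_measurable (completion M)"
proof (rule measurableI)
  fix A :: "'b set" assume [measurable]: "A \<in> sets borel"
  have "{x \<in> space M. f x \<in> A} \<in> sets M"
    by measurable
  then have sets: "{x \<in> space M. f x \<in> A} \<in> sets (completion M)"
    by (rule sets_completionI_sets)
  have "AE x in completion M. x \<in> {x \<in> space M. f x \<in> A} \<longleftrightarrow> x \<in> g -` A \<inter> space (completion M)"
    using AE_completion[OF eq] by eventually_elim auto
  from this sets show "g -` A \<inter> space (completion M) \<in> sets (completion M)"
    by (rule completion.in_sets_AE) simp
qed simp

section \<open>Posterior means\<close>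

lemma sets_posterior [measurable_cong]: "sets (posterior M w) = sets M"
  by (simp add: posterior_def)

context
  fixes M :: "'a measure" and w :: "'a \<Rightarrow> real"
  assumes int: "integrable M w" and nonneg: "AE x in M. 0 \<le> w x" and pos: "0 < (\<integral>x. w x \<partial>M)"
begin

text \<open>With a finite positive normaliser the extended division in \<open>posterior\<close> is a
  real one, as Bochner integration against a density requires. At negative weights both sides
  truncate to 0.\<close>

lemma posterior_eq_density: "posterior M w = density M (\<lambda>x. ennreal (w x / (\<integral>x. w x \<partial>M)))"
proof -
  have "ennreal (w x) / ennreal (\<integral>x. w x \<partial>M) = ennreal (w x / (\<integral>x. w x \<partial>M))" for x
    using pos by (cases "0 \<le> w x") (auto simp: divide_ennreal ennreal_neg divide_nonpos_pos)
  then show ?thesis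
    by (simp add: posterior_def nn_integral_eq_integral[OF int nonneg])
qed

lemma prob_space_posterior: "prob_space (posterior M w)"
proof
  have "emeasure (posterior M w) (space (posterior M w)) = (\<integral>\<^sup>+x. ennreal (w x / (\<integral>x. w x \<partial>M)) \<partial>M)"
    using int by (auto simp: posterior_eq_density emeasure_density intro!: nn_integral_cong)
  also have "\<dots> = ennreal (\<integral>x. w x / (\<integral>x. w x \<partial>M) \<partial>M)"
    using int nonneg pos by (intro nn_integral_eq_integral) auto
  finally show "emeasure (posterior M w) (space (posterior M w)) = 1"
    using pos by simp
qed

text \<open>Points of zero weight are negligible under the posterior, which later permits division
  by the weight.\<close>

lemma AE_posterior_iff: "(AE x in posterior M w. Q x) \<longleftrightarrow> (AE x in M. 0 < w x \<longrightarrow> Q x)"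
proof -
  have [measurable]: "w \<in> borel_measurable M"
    using int by simp
  have meas: "(\<lambda>x. ennreal (w x / (\<integral>x. w x \<partial>M))) \<in> borel_measurable M"
    by measurable
  have iff: "0 < ennreal (w x / (\<integral>x. w x \<partial>M)) \<longleftrightarrow> 0 < w x" for x
    using pos by (simp add: zero_less_divide_iff)
  show ?thesis
    unfolding posterior_eq_density AE_density[OF meas] iff ..
qed

context
  fixes g :: "'a \<Rightarrow> 'b::{banach, second_countable_topology}"
  assumes g: "g \<in> borel_measurable M"
begin

lemma integrable_posterior_iff: "integrable (posterior M w) g \<longleftrightarrow> integrable M (\<lambda>x. w x *\<^sub>R g x)"
proof -
  let ?Z = "\<integral>x. w x \<partial>M"
  have "integrable (posterior M w) g \<longleftrightarrow> integrable M (\<lambda>x. (w x / ?Z) *\<^sub>R g x)"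
    unfolding posterior_eq_density
    using int nonneg pos g by (intro integrable_density) auto
  also have "(\<lambda>x. (w x / ?Z) *\<^sub>R g x) = (\<lambda>x. inverse ?Z *\<^sub>R (w x *\<^sub>R g x))"
    by (simp add: divide_inverse_commute)
  also have "integrable M \<dots> \<longleftrightarrow> integrable M (\<lambda>x. w x *\<^sub>R g x)" (is "?l \<longleftrightarrow> ?r")
  proof
    assume ?l
    then have "integrable M (\<lambda>x. ?Z *\<^sub>R (inverse ?Z *\<^sub>R (w x *\<^sub>R g x)))"
      by (rule integrable_scaleR_right)
    also have "(\<lambda>x. ?Z *\<^sub>R (inverse ?Z *\<^sub>R (w x *\<^sub>R g x))) = (\<lambda>x. w x *\<^sub>R g x)"
      using pos by (simp add: mult.assoc[symmetric])
    finally show ?r .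
  qed (rule integrable_scaleR_right)
  finally show ?thesis .
qed

lemma integral_posterior: "(\<integral>x. g x \<partial>posterior M w) = (\<integral>x. w x *\<^sub>R g x \<partial>M) /\<^sub>R (\<integral>x. w x \<partial>M)"
proof -
  let ?Z = "\<integral>x. w x \<partial>M"
  have "(\<integral>x. g x \<partial>posterior M w) = (\<integral>x. (w x / ?Z) *\<^sub>R g x \<partial>M)"
    unfolding posterior_eq_density
    using int nonneg pos g by (intro integral_density) auto
  also have "(\<lambda>x. (w x / ?Z) *\<^sub>R g x) = (\<lambda>x. inverse ?Z *\<^sub>R (w x *\<^sub>R g x))"
    by (simp add: divide_inverse_commute)
  finally show ?thesis
    by (simp del: scaleR_scaleR)
qed

end

end

section \<open>The derivative of a posterior mean\<close>

text \<open>\<open>T\<close> is the logarithmic derivative of the weight, so the derivatives of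
  normaliser and numerator, divided by the normaliser, are posterior means of \<open>T\<close> and
  \<open>T x *\<^sub>R g x\<close>. \<open>G\<^sub>1\<close> dominates the quotients of the
  normaliser, \<open>G\<close> those of the numerator.\<close>

lemma posterior_mean_has_vector_derivative:
  fixes w :: "real \<Rightarrow> 'a \<Rightarrow> real" and g :: "'a \<Rightarrow> 'b::{banach, second_countable_topology}"
  assumes w [measurable]: "\<And>a. w a \<in> borel_measurable M" and g [measurable]: "g \<in> borel_measurable M"
    and nonneg: "\<And>a. AE x in M. 0 \<le> w a x"
    and int: "integrable M (w a\<^sub>0)" and pos: "0 < (\<integral>x. w a\<^sub>0 x \<partial>M)"
    and int_g: "integrable (posterior M (w a\<^sub>0)) g"
    and deriv: "AE x in M. ((\<lambda>a. w a x) has_real_derivative w a\<^sub>0 x * T x) (at a\<^sub>0)"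
    and "0 < \<delta>\<^sub>0" and G: "integrable M G" and G1: "integrable M G\<^sub>1"
    and bound: "\<And>\<delta>. \<delta> \<noteq> 0 \<Longrightarrow> \<bar>\<delta>\<bar> \<le> \<delta>\<^sub>0 \<Longrightarrow>
      AE x in M. norm (((w (a\<^sub>0 + \<delta>) x - w a\<^sub>0 x) / \<delta>) *\<^sub>R g x) \<le> G x"
    and bound1: "\<And>\<delta>. \<delta> \<noteq> 0 \<Longrightarrow> \<bar>\<delta>\<bar> \<le> \<delta>\<^sub>0 \<Longrightarrow>
      AE x in M. \<bar>(w (a\<^sub>0 + \<delta>) x - w a\<^sub>0 x) / \<delta>\<bar> \<le> G\<^sub>1 x"
  defines "N \<equiv> completion (posterior M (w a\<^sub>0))"
  shows "((\<lambda>a. \<integral>x. g x \<partial>posterior M (w a)) has_vector_derivative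
      (\<integral>x. T x *\<^sub>R g x \<partial>N) - (\<integral>x. T x \<partial>N) *\<^sub>R (\<integral>x. g x \<partial>N)) (at a\<^sub>0)"
    and "\<forall>\<^sub>F a in nhds a\<^sub>0. prob_space (posterior M (w a)) \<and> integrable (posterior M (w a)) g"
    and "integrable N T" and "integrable N (\<lambda>x. T x *\<^sub>R g x)"
proof -
  define Z where "Z a = (\<integral>x. w a x \<partial>M)" for a
  define A where "A a = (\<integral>x. w a x *\<^sub>R g x \<partial>M)" for a
  have wg: "(\<lambda>x. w a x *\<^sub>R g x) \<in> borel_measurable M" for a
    by measurable
  have int_wg: "integrable M (\<lambda>x. w a\<^sub>0 x *\<^sub>R g x)"
    using int_g integrable_posterior_iff[OF int nonneg pos g] by simp

  \<comment> \<open>\<open>D\<close> replaces \<open>w a\<^sub>0 x * T x\<close> by a measurable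
    function, so that it can be integrated over \<open>M\<close>.\<close>
  obtain D where D [measurable]: "D \<in> borel_measurable M" and D_eq: "AE x in M. D x = w a\<^sub>0 x * T x"
    using AE_derivative_measurable[OF w deriv[unfolded has_real_derivative_iff_has_vector_derivative]] .
  have deriv_w: "AE x in M. ((\<lambda>a. w a x) has_vector_derivative D x) (at a\<^sub>0)"
    using deriv D_eq by eventually_elim (simp add: has_real_derivative_iff_has_vector_derivative)
  have deriv_wg: "AE x in M. ((\<lambda>a. w a x *\<^sub>R g x) has_vector_derivative D x *\<^sub>R g x) (at a\<^sub>0)"
    using deriv_w by eventually_elim (auto intro!: derivative_eq_intros simp: has_real_derivative_iff_has_vector_derivative)
  have Dg: "(\<lambda>x. D x *\<^sub>R g x) \<in> borel_measurable M"
    by measurable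
  have bound_w: "AE x in M. norm ((w (a\<^sub>0 + \<delta>) x - w a\<^sub>0 x) /\<^sub>R \<delta>) \<le> G\<^sub>1 x"
    if "\<delta> \<noteq> 0" "\<bar>\<delta>\<bar> \<le> \<delta>\<^sub>0" for \<delta>
    using bound1[OF that] by (simp add: divide_inverse_commute)
  have bound_wg: "AE x in M. norm ((w (a\<^sub>0 + \<delta>) x *\<^sub>R g x - w a\<^sub>0 x *\<^sub>R g x) /\<^sub>R \<delta>) \<le> G x"
    if "\<delta> \<noteq> 0" "\<bar>\<delta>\<bar> \<le> \<delta>\<^sub>0" for \<delta>
    using bound[OF that]
    by (simp add: divide_inverse_commute flip: scaleR_diff_left)
  note dom_w = integral_has_vector_derivative_dominated[where f = w, OF w D int deriv_w \<open>0 < \<delta>\<^sub>0\<close> G1 bound_w]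
  note dom_wg = integral_has_vector_derivative_dominated[where f = "\<lambda>a x. w a x *\<^sub>R g x",
      OF wg Dg int_wg deriv_wg \<open>0 < \<delta>\<^sub>0\<close> G bound_wg]

  have Z_deriv: "(Z has_real_derivative (\<integral>x. D x \<partial>M)) (at a\<^sub>0)"
    using dom_w(3) unfolding Z_def has_real_derivative_iff_has_vector_derivative .
  have A_deriv: "(A has_vector_derivative (\<integral>x. D x *\<^sub>R g x \<partial>M)) (at a\<^sub>0)"
    using dom_wg(3) unfolding A_def .
  have Z_pos: "Z a\<^sub>0 > 0"
    using pos by (simp add: Z_def)
  have near: "\<forall>\<^sub>F a in nhds a\<^sub>0. \<bar>a - a\<^sub>0\<bar> < \<delta>\<^sub>0"
    using \<open>0 < \<delta>\<^sub>0\<close> by (auto simp: eventually_nhds_metric dist_real_def)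
  \<comment> \<open>The normaliser is differentiable, hence continuous, at \<open>a\<^sub>0\<close>,
    so it stays positive nearby and the posteriors there are well defined.\<close>
  have Z_near: "\<forall>\<^sub>F a in nhds a\<^sub>0. 0 < Z a"
    using DERIV_isCont[OF Z_deriv] Z_pos
    by (auto simp: isCont_def tendsto_nhds_iff intro: order_tendstoD)
  have ev: "\<forall>\<^sub>F a in nhds a\<^sub>0. integrable M (w a) \<and> integrable M (\<lambda>x. w a x *\<^sub>R g x) \<and> 0 < Z a"
    using near Z_near
  proof eventually_elim
    case (elim a)
    then show ?case
      using dom_w(2)[of "a - a\<^sub>0"] dom_wg(2)[of "a - a\<^sub>0"] by simp
  qed
  show "\<forall>\<^sub>F a in nhds a\<^sub>0. prob_space (posterior M (w a)) \<and> integrable (posterior M (w a)) g"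
    using ev
  proof eventually_elim
    case (elim a)
    then show ?case
      using prob_space_posterior[OF _ nonneg[of a]] integrable_posterior_iff[OF _ nonneg[of a] _ g]
      by (simp add: Z_def)
  qed
  have mean_ev: "\<forall>\<^sub>F a in nhds a\<^sub>0. A a /\<^sub>R Z a = (\<integral>x. g x \<partial>posterior M (w a))"
    using ev
  proof eventually_elim
    case (elim a)
    then show ?case
      using integral_posterior[OF _ nonneg[of a] _ g] by (simp add: Z_def A_def)
  qed

  \<comment> \<open>\<open>T\<close> may fail to be measurable; \<open>S\<close> is a measurable version of it.\<close>
  define S where "S x = D x / w a\<^sub>0 x" for x
  have S [measurable]: "S \<in> borel_measurable M"
    unfolding S_def by measurable
  \<comment> \<open>Where the weight vanishes, \<open>D x = w a\<^sub>0 x * T x\<close> is 0 for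
    almost every such point, so both sides are 0; elsewhere the division cancels.\<close>
  have wS: "AE x in M. w a\<^sub>0 x * S x = D x"
    using D_eq by eventually_elim (auto simp: S_def)
  have wSg: "AE x in M. w a\<^sub>0 x *\<^sub>R (S x *\<^sub>R g x) = D x *\<^sub>R g x"
    using wS by eventually_elim simp
  let ?P = "posterior M (w a\<^sub>0)"
  note posterior = int nonneg[of a\<^sub>0] pos
  \<comment> \<open>Only points of positive weight count here, and there the weight cancels from
    \<open>D x / w a\<^sub>0 x\<close>.\<close>
  have ST: "AE x in ?P. S x = T x"
    unfolding AE_posterior_iff[OF posterior]
    using D_eq by eventually_elim (auto simp: S_def)
  have TN [measurable]: "T \<in> borel_measurable N"
    unfolding N_def by (rule borel_measurable_completion_AE[OF _ ST]) measurable
  have gN [measurable]: "g \<in> borel_measurable N" and SN [measurable]: "S \<in> borel_measurable N"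
    unfolding N_def by (rule measurable_completion, measurable)+
  have STg: "AE x in N. S x = T x" "AE x in N. S x *\<^sub>R g x = T x *\<^sub>R g x"
    using AE_completion[OF ST] unfolding N_def by (auto elim: eventually_mono)

  have int_S: "integrable ?P S"
    unfolding integrable_posterior_iff[OF posterior S]
    using dom_w(1) wS by (subst integrable_cong_AE[where g = D]) auto
  then show "integrable N T"
    using integrable_cong_AE[OF SN TN STg(1)] by (simp add: N_def integrable_completion)
  have int_Sg: "integrable ?P (\<lambda>x. S x *\<^sub>R g x)"
    using dom_wg(1) wSg
    by (subst integrable_posterior_iff[OF posterior], measurable)
      (subst integrable_cong_AE[where g = "\<lambda>x. D x *\<^sub>R g x"], auto)
  moreover have "integrable N (\<lambda>x. S x *\<^sub>R g x) \<longleftrightarrow> integrable N (\<lambda>x. T x *\<^sub>R g x)"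
    using STg(2) by (intro integrable_cong_AE) auto
  ultimately show "integrable N (\<lambda>x. T x *\<^sub>R g x)"
    by (simp add: N_def integrable_completion)

  have E_T: "(\<integral>x. T x \<partial>N) = (\<integral>x. D x \<partial>M) / Z a\<^sub>0"
  proof -
    have "(\<integral>x. T x \<partial>N) = (\<integral>x. S x \<partial>N)"
      using STg(1) by (intro integral_cong_AE) (auto elim: eventually_mono)
    also have "\<dots> = (\<integral>x. S x \<partial>?P)"
      unfolding N_def by (rule integral_completion) measurable
    also have "\<dots> = (\<integral>x. w a\<^sub>0 x *\<^sub>R S x \<partial>M) /\<^sub>R Z a\<^sub>0"
      unfolding Z_def by (rule integral_posterior[OF posterior S])
    also have "(\<integral>x. w a\<^sub>0 x *\<^sub>R S x \<partial>M) = (\<integral>x. D x \<partial>M)"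
      using wS by (intro integral_cong_AE) auto
    finally show ?thesis
      by (simp add: divide_inverse_commute)
  qed
  have E_Tg: "(\<integral>x. T x *\<^sub>R g x \<partial>N) = (\<integral>x. D x *\<^sub>R g x \<partial>M) /\<^sub>R Z a\<^sub>0"
  proof -
    have "(\<integral>x. T x *\<^sub>R g x \<partial>N) = (\<integral>x. S x *\<^sub>R g x \<partial>N)"
      using STg(2) by (intro integral_cong_AE) (auto elim: eventually_mono)
    also have "\<dots> = (\<integral>x. S x *\<^sub>R g x \<partial>?P)"
      unfolding N_def by (rule integral_completion) measurable
    also have "\<dots> = (\<integral>x. w a\<^sub>0 x *\<^sub>R (S x *\<^sub>R g x) \<partial>M) /\<^sub>R Z a\<^sub>0"
      unfolding Z_def by (rule integral_posterior[OF posterior]) measurable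
    also have "(\<integral>x. w a\<^sub>0 x *\<^sub>R (S x *\<^sub>R g x) \<partial>M) = (\<integral>x. D x *\<^sub>R g x \<partial>M)"
      using wSg by (intro integral_cong_AE) auto
    finally show ?thesis .
  qed
  have E_g: "(\<integral>x. g x \<partial>N) = A a\<^sub>0 /\<^sub>R Z a\<^sub>0"
  proof -
    have "(\<integral>x. g x \<partial>N) = (\<integral>x. g x \<partial>?P)"
      unfolding N_def by (rule integral_completion) measurable
    then show ?thesis
      using integral_posterior[OF posterior g] by (simp add: A_def Z_def)
  qed

  \<comment> \<open>The quotient rule for a vector numerator, obtained as the product rule for
    scaling by the reciprocal of the normaliser.\<close>
  have "((\<lambda>a. inverse (Z a) *\<^sub>R A a) has_vector_derivative
      inverse (Z a\<^sub>0) *\<^sub>R (\<integral>x. D x *\<^sub>R g x \<partial>M)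
        + (- (inverse (Z a\<^sub>0) * (\<integral>x. D x \<partial>M) * inverse (Z a\<^sub>0))) *\<^sub>R A a\<^sub>0) (at a\<^sub>0)"
    using Z_pos by (intro has_vector_derivative_scaleR DERIV_inverse' Z_deriv A_deriv) auto
  also have "inverse (Z a\<^sub>0) *\<^sub>R (\<integral>x. D x *\<^sub>R g x \<partial>M)
        + (- (inverse (Z a\<^sub>0) * (\<integral>x. D x \<partial>M) * inverse (Z a\<^sub>0))) *\<^sub>R A a\<^sub>0
      = (\<integral>x. T x *\<^sub>R g x \<partial>N) - (\<integral>x. T x \<partial>N) *\<^sub>R (\<integral>x. g x \<partial>N)"
    by (simp add: E_T E_Tg E_g divide_inverse_commute mult_ac)
  finally show "((\<lambda>a. \<integral>x. g x \<partial>posterior M (w a)) has_vector_derivative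
      (\<integral>x. T x *\<^sub>R g x \<partial>N) - (\<integral>x. T x \<partial>N) *\<^sub>R (\<integral>x. g x \<partial>N)) (at a\<^sub>0)"
    \<comment> \<open>The quotient equals the posterior mean near \<open>a\<^sub>0\<close> and at
      \<open>a\<^sub>0\<close> itself, so the derivative carries over.\<close>
    using mean_ev eventually_nhds_x_imp_x[OF mean_ev]
    by (subst (asm) has_vector_derivative_cong_ev) auto
qed

text \<open>Coordinate projections commute with the integral, and total mass one lets the constant
  term cancel one of the two mixed terms.\<close>

lemma (in prob_space) covariance_vec_eq:
  fixes g :: "'a \<Rightarrow> real ^ 's"
  assumes g: "integrable M g" and T: "integrable M T" and Tg: "integrable M (\<lambda>x. T x *\<^sub>R g x)"
  shows "covariance_vec M g T = (\<integral>x. T x *\<^sub>R g x \<partial>M) - (\<integral>x. T x \<partial>M) *\<^sub>R (\<integral>x. g x \<partial>M)"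
proof (unfold vec_eq_iff, rule allI)
  fix j
  have nth: "(\<integral>x. f x \<partial>M) $ j = (\<integral>x. f x $ j \<partial>M)" "integrable M (\<lambda>x. f x $ j)"
    if "integrable M f" for f :: "'a \<Rightarrow> real ^ 's"
    using that by (auto simp: integral_bounded_linear[OF bounded_linear_vec_nth]
        intro: integrable_bounded_linear[OF bounded_linear_vec_nth])
  let ?m = "\<integral>x. g x $ j \<partial>M" and ?t = "\<integral>x. T x \<partial>M"
  have Tgj: "integrable M (\<lambda>x. T x * g x $ j)"
    using nth(2)[OF Tg] by simp
  have "covariance_vec M g T $ j = (\<integral>x. T x * g x $ j - ?t * g x $ j - ?m * T x + ?m * ?t \<partial>M)"
    by (simp add: covariance_vec_def algebra_simps)
  also have "\<dots> = (\<integral>x. T x * g x $ j \<partial>M) - ?t * ?m"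
    using Tgj nth(2)[OF g] T by (simp add: prob_space algebra_simps)
  also have "\<dots> = ((\<integral>x. T x *\<^sub>R g x \<partial>M) - ?t *\<^sub>R (\<integral>x. g x \<partial>M)) $ j"
    by (simp add: nth(1)[OF g] nth(1)[OF Tg])
  finally show "covariance_vec M g T $ j = ((\<integral>x. T x *\<^sub>R g x \<partial>M) - ?t *\<^sub>R (\<integral>x. g x \<partial>M)) $ j" .
qed

section \<open>Distortion functions and distribution functions\<close>

lemma distortion_deriv_works:
  assumes "distortion_function h" and "y \<in> {0..1}"
  shows "(h has_real_derivative distortion_deriv h y) (at y within {0..1})"
  using assms unfolding distortion_function_def distortion_deriv_def differentiable_on_def
    has_real_derivative_iff_has_vector_derivative
  by (simp add: vector_derivative_works)

text \<open>Difference quotients of a monotone function are nonnegative, and so is their limit,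
  because no point of the unit interval is isolated.\<close>

lemma distortion_deriv_nonneg:
  assumes h: "distortion_function h" and y: "y \<in> {0..1}"
  shows "0 \<le> distortion_deriv h y"
proof (rule tendsto_lowerbound)
  show "((\<lambda>z. (h z - h y) / (z - y)) \<longlongrightarrow> distortion_deriv h y) (at y within {0..1})"
    using distortion_deriv_works[OF h y] by (simp add: has_field_derivative_iff)
  have "mono_on {0..1} h"
    using h by (simp add: distortion_function_def)
  then have "0 \<le> (h z - h y) / (z - y)" if "z \<in> {0..1}" for z
    using that y mono_onD[of "{0..1}" h y z] mono_onD[of "{0..1}" h z y]
    by (cases "y \<le> z") (auto simp: zero_le_divide_iff)
  then show "\<forall>\<^sub>F z in at y within {0..1}. 0 \<le> (h z - h y) / (z - y)"
    by (auto simp: eventually_at_filter)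
  show "at y within {0..1} \<noteq> bot"
    using y by (simp add: trivial_limit_within islimpt_Icc)
qed

lemma distortion_deriv_ident:
  assumes "\<And>y. y \<in> {0..1} \<Longrightarrow> h y = y" and y: "y \<in> {0..1}"
  shows "distortion_deriv h y = 1"
  unfolding distortion_deriv_def
proof (rule vector_derivative_within_closed_interval)
  show "(h has_vector_derivative 1) (at y within {0..1})"
    by (rule has_vector_derivative_transform[OF y _ has_vector_derivative_id]) (simp add: assms)
qed (use y in auto)

text \<open>The derivative is a pointwise limit of difference quotients whose nodes depend
  measurably on the point.\<close>

lemma borel_measurable_distortion_deriv:
  assumes h: "distortion_function h" and [measurable]: "F \<in> borel_measurable M"
    and F: "\<And>x. x \<in> space M \<Longrightarrow> F x \<in> {0..1}"
  shows "(\<lambda>x. distortion_deriv h (F x)) \<in> borel_measurable M"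
proof -
  \<comment> \<open>Clamping the argument extends \<open>h\<close> from the unit interval to a
    function monotone on the whole line, hence Borel.\<close>
  define k where "k y = h (max 0 (min 1 y))" for y
  have "mono k"
    using h unfolding k_def distortion_function_def by (auto intro!: monoI mono_onD[of "{0..1}" h])
  then have [measurable]: "k \<in> borel_measurable borel"
    by (rule borel_measurable_mono)
  have k_eq: "k y = h y" if "y \<in> {0..1}" for y
    using that by (auto simp: k_def)
  \<comment> \<open>\<open>u i y\<close> is a point of the unit interval other than \<open>y\<close>, on whichever side of \<open>y\<close> there is room.\<close>
  define u where "u i y = y + ((if y < 1 then 1 else 0) - y) * inverse (real (Suc i))" for i y
  have u_meas [measurable]: "u i \<in> borel_measurable borel" for i
    unfolding u_def by measurable
  have "distortion_deriv h y = lim (\<lambda>i. (k (u i y) - k y) / (u i y - y))" if y: "y \<in> {0..1}" for y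
  proof -
    have u: "u i y \<in> {0..1} - {y}" for i
    proof (cases "y < 1")
      case True
      have "u i y = y + (1 - y) * inverse (real (Suc i))"
        using True by (simp add: u_def)
      moreover have "0 < (1 - y) * inverse (real (Suc i))"
        using True by simp
      moreover have "(1 - y) * inverse (real (Suc i)) \<le> 1 - y"
        using True by (intro mult_left_le) (auto simp: field_simps)
      ultimately have "y < u i y" "u i y \<le> 1"
        by simp_all
      then show ?thesis
        using y by simp
    next
      case False
      then have "y = 1"
        using y by simp
      then show ?thesis
        by (auto simp: u_def field_simps)
    qed
    have "(\<lambda>i. u i y) \<longlonglongrightarrow> y + ((if y < 1 then 1 else 0) - y) * 0"
      unfolding u_def by (intro tendsto_intros LIMSEQ_inverse_real_of_nat)
    then have lim: "(\<lambda>i. (h (u i y) - h y) / (u i y - y)) \<longlonglongrightarrow> distortion_deriv h y"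
      using distortion_deriv_works[OF h y] u
      unfolding has_field_derivative_iff tendsto_at_iff_sequentially comp_def by auto
    moreover have "k (u i y) = h (u i y)" for i
      using u by (intro k_eq) auto
    ultimately show ?thesis
      by (auto simp: k_eq[OF y] dest: limI)
  qed
  then have "(\<lambda>x. distortion_deriv h (F x)) \<in> borel_measurable M \<longleftrightarrow>
      (\<lambda>x. lim (\<lambda>i. (k (u i (F x)) - k (F x)) / (u i (F x) - F x))) \<in> borel_measurable M"
    using F by (intro measurable_cong) auto
  also have "\<dots>"
    by measurable
  finally show ?thesis .
qed

lemma joint_cdf_range: "prob_space M \<Longrightarrow> joint_cdf M z \<in> {0..1}"
  by (simp add: joint_cdf_def prob_space.prob_le_1)

text \<open>The distribution function gives the measures of the sections of the measurable set
  \<open>Q\<close>. Measurability of the identity, in place of an equality of sigma-algebras, admits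
  measures living on a subspace, such as the prior.\<close>

lemma borel_measurable_joint_cdf:
  fixes M :: "(real ^ 'n) measure"
  assumes "finite_measure M" and [measurable]: "(\<lambda>t. t) \<in> borel_measurable M"
  shows "joint_cdf M \<in> borel_measurable borel"
proof -
  interpret finite_measure M by fact
  have [measurable]: "(\<lambda>z :: real ^ 'n. z $ i) \<in> borel_measurable borel" for i
    by (intro borel_measurable_continuous_onI continuous_intros)
  define Q where "Q = {p \<in> space (borel \<Otimes>\<^sub>M M). \<forall>i. snd p $ i \<le> fst p $ i}"
  have "Q \<in> sets (borel \<Otimes>\<^sub>M M)"
    unfolding Q_def by measurable
  then have "(\<lambda>z. enn2real (emeasure M (Pair z -` Q))) \<in> borel_measurable borel"
    by (intro borel_measurable_enn2real measurable_emeasure_Pair)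
  also have "(\<lambda>z. enn2real (emeasure M (Pair z -` Q))) = joint_cdf M"
    by (auto simp: fun_eq_iff joint_cdf_def measure_def Q_def space_pair_measure less_eq_vec_def
        intro!: arg_cong[where f = "\<lambda>A. enn2real (emeasure M A)"])
  finally show ?thesis .
qed

section \<open>Logarithmic differentiation of the weight\<close>

text \<open>Near \<open>a\<close> the product is a constant times the exponential of the sum of
  logarithms. The factors \<open>c i\<close>, later the values of the model density, stay outside
  the logarithm because they may vanish.\<close>

lemma log_differentiable_prod_has_derivative:
  fixes c :: "'i \<Rightarrow> real"
  assumes I: "finite I" and u: "\<And>i. i \<in> I \<Longrightarrow> log_differentiable_at (u i) a"
    and v: "log_differentiable_at v a"
  shows "((\<lambda>\<alpha>. (\<Prod>i\<in>I. c i * u i \<alpha>) * v \<alpha>) has_real_derivative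
    ((\<Prod>i\<in>I. c i * u i a) * v a) * deriv (\<lambda>\<alpha>. ln (v \<alpha>) + (\<Sum>i\<in>I. ln (u i \<alpha>))) a) (at a)"
proof -
  define T where "T \<alpha> = ln (v \<alpha>) + (\<Sum>i\<in>I. ln (u i \<alpha>))" for \<alpha>
  have "T differentiable (at a)"
    unfolding T_def using assms
    by (intro differentiable_add differentiable_sum) (auto simp: log_differentiable_at_def)
  then have T: "(T has_real_derivative deriv T a) (at a)"
    by (simp add: DERIV_deriv_iff_real_differentiable)
  have "\<forall>\<^sub>F \<alpha> in nhds a. 0 < v \<alpha> \<and> (\<forall>i\<in>I. 0 < u i \<alpha>)"
    using assms by (auto simp: log_differentiable_at_def intro!: eventually_conj eventually_ball_finite)
  then have eq: "\<forall>\<^sub>F \<alpha> in nhds a. (\<Prod>i\<in>I. c i * u i \<alpha>) * v \<alpha> = (\<Prod>i\<in>I. c i) * exp (T \<alpha>)"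
    by eventually_elim (simp add: T_def exp_add exp_sum I prod.distrib mult_ac)
  have "((\<lambda>\<alpha>. (\<Prod>i\<in>I. c i) * exp (T \<alpha>)) has_real_derivative
      ((\<Prod>i\<in>I. c i) * exp (T a)) * deriv T a) (at a)"
    using T by (auto intro!: derivative_eq_intros)
  then show ?thesis
    using DERIV_cong_ev[OF refl eq refl] eventually_nhds_x_imp_x[OF eq] by (simp add: T_def[abs_def])
qed

section \<open>The distorted Bayes model\<close>

context bayes_model
begin

lemma sets_prior [measurable_cong]: "sets prior = sets (restrict_space borel \<Theta>)"
  by (subst prior_dens) (simp add: sets_restrict_space)

lemma space_prior: "space prior = \<Theta>"
  using sets_eq_imp_space_eq[OF sets_prior] by (simp add: space_restrict_space)

lemma borel_measurable_model_dens: "(\<lambda>\<theta>. fX \<theta> y) \<in> borel_measurable prior"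
proof -
  have "(\<lambda>\<theta>. (\<lambda>(\<theta>, y). fX \<theta> y) (\<theta>, y)) \<in> borel_measurable (restrict_space borel \<Theta>)"
    by (rule measurable_compose[OF _ model_dens_measurable]) measurable
  then show ?thesis
    by (simp add: measurable_cong_sets[OF sets_prior refl])
qed

lemma borel_measurable_prior_cdf: "joint_cdf prior \<in> borel_measurable prior"
proof -
  interpret prob_space prior
    by (rule prior_prob)
  have id: "(\<lambda>t. t) \<in> prior \<rightarrow>\<^sub>M borel"
    by (auto simp: measurable_cong_sets[OF sets_prior refl] intro: measurable_restrict_space1)
  show ?thesis
    using measurable_compose[OF id borel_measurable_joint_cdf[OF finite_measure_axioms id]] .
qed

text \<open>Writing the distribution function as a parameter integral of the jointly measurable
  density gives measurability in \<theta> by Tonelli's theorem.\<close>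

lemma borel_measurable_model_cdf: "(\<lambda>\<theta>. joint_cdf (P \<theta>) y) \<in> borel_measurable prior"
proof -
  have joint: "(\<lambda>(\<theta>, t). ennreal (fX \<theta> t) * indicator {..y} t)
      \<in> borel_measurable (restrict_space borel \<Theta> \<Otimes>\<^sub>M lborel)"
  proof -
    have [measurable]: "(\<lambda>p. fX (fst p) (snd p)) \<in> borel_measurable (restrict_space borel \<Theta> \<Otimes>\<^sub>M lborel)"
      using model_dens_measurable
      by (simp add: case_prod_beta' cong: measurable_cong_sets sets_pair_measure_cong)
    have [measurable]: "{..y} \<in> sets borel"
      by (intro borel_closed closed_eucl_atMost)
    show ?thesis
      by (simp add: case_prod_beta')
  qed
  have "(\<lambda>\<theta>. enn2real (\<integral>\<^sup>+t. ennreal (fX \<theta> t) * indicator {..y} t \<partial>lborel))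
      \<in> borel_measurable (restrict_space borel \<Theta>)"
    by (intro borel_measurable_enn2real lborel.borel_measurable_nn_integral joint)
  moreover have "joint_cdf (P \<theta>) y = enn2real (\<integral>\<^sup>+t. ennreal (fX \<theta> t) * indicator {..y} t \<partial>lborel)"
    if "\<theta> \<in> \<Theta>" for \<theta>
  proof -
    have "(\<lambda>t. (\<lambda>(\<theta>, y). fX \<theta> y) (\<theta>, t)) \<in> borel_measurable borel"
      using that by (intro measurable_compose[OF _ model_dens_measurable] measurable_Pair) (auto simp: space_restrict_space)
    moreover have "{t \<in> space (P \<theta>). t \<le> y} = {..y}"
      by (auto simp: model_dens[OF that])
    moreover have "{..y} \<in> sets borel"
      by (intro borel_closed closed_eucl_atMost)
    ultimately show ?thesis
      by (simp add: joint_cdf_def measure_def model_dens[OF that] emeasure_density)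
  qed
  ultimately show ?thesis
    by (subst measurable_cong_sets[OF sets_prior refl], subst measurable_cong)
      (auto simp: space_restrict_space)
qed

text \<open>The unnormalised density of the distorted posterior with respect to the undistorted
  prior; the base measure thus stays fixed while the distortion varies.\<close>

definition distorted_weight :: "nat \<Rightarrow> (nat \<Rightarrow> real ^ 'd) \<Rightarrow> (real \<Rightarrow> real) \<Rightarrow> real ^ 'k \<Rightarrow> real"
  where "distorted_weight n x h \<theta> =
    distorted_likelihood P fX n x h \<theta> * distortion_deriv h (joint_cdf prior \<theta>)"

context
  fixes h :: "real \<Rightarrow> real"
  assumes h: "distortion_function h"
begin

lemma borel_measurable_distorted_likelihood: "distorted_likelihood P fX n x h \<in> borel_measurable prior"
  unfolding distorted_likelihood_def
  by (intro borel_measurable_prod borel_measurable_times borel_measurable_model_dens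
      borel_measurable_distortion_deriv[OF h] borel_measurable_model_cdf joint_cdf_range model_prob)
    (simp add: space_prior)

lemma borel_measurable_distorted_prior_density:
  "(\<lambda>\<theta>. distortion_deriv h (joint_cdf prior \<theta>)) \<in> borel_measurable prior"
  by (intro borel_measurable_distortion_deriv[OF h] borel_measurable_prior_cdf joint_cdf_range prior_prob)

lemma borel_measurable_distorted_weight: "distorted_weight n x h \<in> borel_measurable prior"
  unfolding distorted_weight_def
  by (intro borel_measurable_times borel_measurable_distorted_likelihood
      borel_measurable_distorted_prior_density)

lemma distorted_likelihood_nonneg: "\<theta> \<in> \<Theta> \<Longrightarrow> 0 \<le> distorted_likelihood P fX n x h \<theta>"
  unfolding distorted_likelihood_def
  by (intro prod_nonneg ballI mult_nonneg_nonneg model_dens_nonneg distortion_deriv_nonneg[OF h]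
      joint_cdf_range model_prob)

lemma distorted_prior_density_nonneg: "0 \<le> distortion_deriv h (joint_cdf prior \<theta>)"
  by (intro distortion_deriv_nonneg[OF h] joint_cdf_range prior_prob)

lemma distorted_weight_nonneg: "\<theta> \<in> \<Theta> \<Longrightarrow> 0 \<le> distorted_weight n x h \<theta>"
  unfolding distorted_weight_def
  by (intro mult_nonneg_nonneg distorted_likelihood_nonneg distorted_prior_density_nonneg)

text \<open>Successive densities multiply, and by the same rule the normalisers agree. Nonnegativity
  of the prior factor lets the product pass through \<open>ennreal\<close>.\<close>

lemma distorted_posterior_eq_posterior:
  "distorted_posterior prior P fX n x h = posterior prior (distorted_weight n x h)"
proof -
  note [measurable] = borel_measurable_distorted_likelihood borel_measurable_distorted_prior_density
    borel_measurable_distorted_weight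
  let ?L = "distorted_likelihood P fX n x h" and ?p = "\<lambda>\<theta>. distortion_deriv h (joint_cdf prior \<theta>)"
  have weight: "ennreal (?p \<theta>) * ennreal (?L \<theta>) = ennreal (distorted_weight n x h \<theta>)" for \<theta>
    using distorted_prior_density_nonneg[of \<theta>] by (simp add: distorted_weight_def ennreal_mult' mult.commute)
  have norm: "(\<integral>\<^sup>+\<theta>. ennreal (?L \<theta>) \<partial>distorted_prior prior h)
      = (\<integral>\<^sup>+\<theta>. ennreal (distorted_weight n x h \<theta>) \<partial>prior)"
    by (simp add: distorted_prior_def nn_integral_density weight)
  show ?thesis
    unfolding distorted_posterior_def posterior_def norm
    by (simp add: distorted_prior_def density_density_eq ennreal_times_divide weight)
qed

end

text \<open>Every distortion factor is 1 here, which identifies the posterior at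
  \<open>\<alpha>\<^sub>0\<close> with the undistorted one. Membership in \<Theta> ensures that
  \<open>P \<theta>\<close> is a probability measure, so its distribution function stays in the unit
  interval.\<close>

lemma distorted_weight_ident:
  assumes "\<And>y. y \<in> {0..1} \<Longrightarrow> h y = y" and "\<theta> \<in> \<Theta>"
  shows "distorted_weight n x h \<theta> = likelihood fX n x \<theta>"
  using assms by (simp add: distorted_weight_def distorted_likelihood_def likelihood_def
      distortion_deriv_ident joint_cdf_range model_prob prior_prob del: atLeastAtMost_iff)

lemma borel_measurable_likelihood: "likelihood fX n x \<in> borel_measurable prior"
  unfolding likelihood_def by (intro borel_measurable_prod borel_measurable_model_dens)

end

(* The score is a derivative that exists only almost everywhere, so it is in general measurable
   only with respect to the completion of the posterior. *)
theorem theorem3: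
  fixes \<Theta> :: "(real ^ 'k) set"
    and prior :: "(real ^ 'k) measure"
    and f\<^sub>0 :: "real ^ 'k \<Rightarrow> real"
    and P :: "real ^ 'k \<Rightarrow> (real ^ 'd) measure"
    and fX :: "real ^ 'k \<Rightarrow> real ^ 'd \<Rightarrow> real"
    and n :: nat and x :: "nat \<Rightarrow> real ^ 'd"
    and h :: "real \<Rightarrow> real \<Rightarrow> real" and \<alpha>\<^sub>0 \<delta>\<^sub>0 :: real
    and g :: "real ^ 'k \<Rightarrow> real ^ 's"
    and G G\<^sub>1 :: "real ^ 'k \<Rightarrow> real"
  assumes model: "bayes_model \<Theta> prior f\<^sub>0 P fX"
    and bayes_pos: "0 < (\<integral>\<^sup>+ \<theta>. ennreal (likelihood fX n x \<theta>) \<partial>prior)"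
    and bayes_finite: "(\<integral>\<^sup>+ \<theta>. ennreal (likelihood fX n x \<theta>) \<partial>prior) < \<infinity>"
    and distortion: "\<And>\<alpha>. distortion_function (h \<alpha>)"
    and h_id: "\<And>y. y \<in> {0..1} \<Longrightarrow> h \<alpha>\<^sub>0 y = y"
    and log_diff_prior:
      "AE \<theta> in prior. log_differentiable_at (\<lambda>\<alpha>. distortion_deriv (h \<alpha>) (joint_cdf prior \<theta>)) \<alpha>\<^sub>0"
    and log_diff_model:
      "AE \<theta> in prior. \<forall>i\<in>{1..n}.
         log_differentiable_at (\<lambda>\<alpha>. distortion_deriv (h \<alpha>) (joint_cdf (P \<theta>) (x i))) \<alpha>\<^sub>0"
    and delta_pos: "0 < \<delta>\<^sub>0"
    and g_measurable: "g \<in> borel_measurable prior"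
    and g_integrable: "integrable (posterior prior (likelihood fX n x)) g"
    and G_integrable: "integrable prior G"
    and G_bound:
      "AE \<theta> in prior. \<forall>\<delta>. \<delta> \<noteq> 0 \<and> \<bar>\<delta>\<bar> \<le> \<delta>\<^sub>0 \<longrightarrow>
         norm (((distorted_likelihood P fX n x (h (\<alpha>\<^sub>0 + \<delta>)) \<theta>
                   * distortion_deriv (h (\<alpha>\<^sub>0 + \<delta>)) (joint_cdf prior \<theta>)
                 - distorted_likelihood P fX n x (h \<alpha>\<^sub>0) \<theta>
                   * distortion_deriv (h \<alpha>\<^sub>0) (joint_cdf prior \<theta>)) / \<delta>) *\<^sub>R g \<theta>) \<le> G \<theta>"
    and G1_integrable: "integrable prior G\<^sub>1"
    and G1_bound:
      "AE \<theta> in prior. \<forall>\<delta>. \<delta> \<noteq> 0 \<and> \<bar>\<delta>\<bar> \<le> \<delta>\<^sub>0 \<longrightarrow>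
         \<bar>(distorted_likelihood P fX n x (h (\<alpha>\<^sub>0 + \<delta>)) \<theta>
              * distortion_deriv (h (\<alpha>\<^sub>0 + \<delta>)) (joint_cdf prior \<theta>)
            - distorted_likelihood P fX n x (h \<alpha>\<^sub>0) \<theta>
              * distortion_deriv (h \<alpha>\<^sub>0) (joint_cdf prior \<theta>)) / \<delta>\<bar> \<le> G\<^sub>1 \<theta>"
  shows "((\<lambda>\<alpha>. \<integral>\<theta>. g \<theta> \<partial>distorted_posterior prior P fX n x (h \<alpha>)) has_vector_derivative
            covariance_vec (completion (posterior prior (likelihood fX n x))) g
              (distortion_score prior P n x h \<alpha>\<^sub>0)) (at \<alpha>\<^sub>0)
       \<and> (\<forall>\<^sub>F \<alpha> in nhds \<alpha>\<^sub>0. prob_space (distorted_posterior prior P fX n x (h \<alpha>))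
            \<and> integrable (distorted_posterior prior P fX n x (h \<alpha>)) g)
       \<and> integrable (completion (posterior prior (likelihood fX n x)))
           (distortion_score prior P n x h \<alpha>\<^sub>0)
       \<and> integrable (completion (posterior prior (likelihood fX n x)))
           (\<lambda>\<theta>. distortion_score prior P n x h \<alpha>\<^sub>0 \<theta> *\<^sub>R g \<theta>)"
proof -
  interpret bayes_model \<Theta> prior f\<^sub>0 P fX
    by (rule model)
  define w where "w \<alpha> = distorted_weight n x (h \<alpha>)" for \<alpha>
  let ?L = "likelihood fX n x" and ?T = "distortion_score prior P n x h \<alpha>\<^sub>0"
  have [measurable]: "w \<alpha> \<in> borel_measurable prior" for \<alpha>
    unfolding w_def by (rule borel_measurable_distorted_weight[OF distortion])
  have [measurable]: "?L \<in> borel_measurable prior"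
    by (rule borel_measurable_likelihood)
  have w_eq: "w \<alpha>\<^sub>0 \<theta> = ?L \<theta>" if "\<theta> \<in> space prior" for \<theta>
    unfolding w_def using that h_id by (intro distorted_weight_ident) (auto simp: space_prior)
  have w_nonneg: "AE \<theta> in prior. 0 \<le> w \<alpha> \<theta>" for \<alpha>
    unfolding w_def by (rule AE_I2) (simp add: distorted_weight_nonneg distortion space_prior)
  have posterior_w: "posterior prior (w \<alpha>\<^sub>0) = posterior prior ?L"
    unfolding posterior_def
    by (intro density_cong) (auto simp: w_eq cong: nn_integral_cong)
  have posterior_distorted: "distorted_posterior prior P fX n x (h \<alpha>) = posterior prior (w \<alpha>)" for \<alpha>
    unfolding w_def by (rule distorted_posterior_eq_posterior[OF distortion])
  have nn: "(\<integral>\<^sup>+\<theta>. ennreal (w \<alpha>\<^sub>0 \<theta>) \<partial>prior) = (\<integral>\<^sup>+\<theta>. ennreal (?L \<theta>) \<partial>prior)"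
    by (intro nn_integral_cong) (simp add: w_eq)
  \<comment> \<open>Well-definedness of Bayes' rule, stated with nonnegative integrals, becomes
    integrability and a positive Bochner integral of the weight.\<close>
  have int: "integrable prior (w \<alpha>\<^sub>0)"
    using bayes_finite nn by (intro integrableI_nonneg w_nonneg) auto
  have pos: "0 < (\<integral>\<theta>. w \<alpha>\<^sub>0 \<theta> \<partial>prior)"
    using bayes_pos unfolding nn[symmetric] nn_integral_eq_integral[OF int w_nonneg] by simp
  have deriv: "AE \<theta> in prior. ((\<lambda>\<alpha>. w \<alpha> \<theta>) has_real_derivative w \<alpha>\<^sub>0 \<theta> * ?T \<theta>) (at \<alpha>\<^sub>0)"
    using log_diff_prior log_diff_model
  proof eventually_elim
    case (elim \<theta>)
    then show ?case
      unfolding w_def distorted_weight_def distorted_likelihood_def distortion_score_def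
      by (intro log_differentiable_prod_has_derivative) auto
  qed
  \<comment> \<open>The hypothesis has one null set for all \<delta>; fixing \<delta> gives the
    weaker form used for differentiation.\<close>
  have bound: "AE \<theta> in prior. norm (((w (\<alpha>\<^sub>0 + \<delta>) \<theta> - w \<alpha>\<^sub>0 \<theta>) / \<delta>) *\<^sub>R g \<theta>) \<le> G \<theta>"
    if "\<delta> \<noteq> 0" "\<bar>\<delta>\<bar> \<le> \<delta>\<^sub>0" for \<delta>
    unfolding w_def distorted_weight_def using G_bound that by (auto elim: eventually_mono)
  have bound1: "AE \<theta> in prior. \<bar>(w (\<alpha>\<^sub>0 + \<delta>) \<theta> - w \<alpha>\<^sub>0 \<theta>) / \<delta>\<bar> \<le> G\<^sub>1 \<theta>"
    if "\<delta> \<noteq> 0" "\<bar>\<delta>\<bar> \<le> \<delta>\<^sub>0" for \<delta>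
    unfolding w_def distorted_weight_def using G1_bound that by (auto elim: eventually_mono)
  have int_g: "integrable (posterior prior (w \<alpha>\<^sub>0)) g"
    using g_integrable by (simp add: posterior_w)
  note main = posterior_mean_has_vector_derivative[where w = w and T = ?T,
      OF \<open>\<And>\<alpha>. w \<alpha> \<in> borel_measurable prior\<close> g_measurable w_nonneg int pos int_g deriv delta_pos
        G_integrable G1_integrable bound bound1, unfolded posterior_w]
  have "prob_space (posterior prior ?L)"
    using prob_space_posterior[OF int w_nonneg pos] by (simp add: posterior_w)
  then interpret N: prob_space "completion (posterior prior ?L)"
    by (rule prob_space.prob_space_completion)
  have "integrable (completion (posterior prior ?L)) g"
    using g_integrable by (simp add: integrable_completion)
  from main N.covariance_vec_eq[OF this main(3,4)] show ?thesis
    by (simp add: posterior_distorted)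
qed

end
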